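(* Let $0\le\varepsilon<1/2$. The set $$\mathcal{A}=P_1 \cup P_2 \cup S_3(P_1) \cup S_4(P_1) \cup S_3S_4(P_1) \cup S_3(P_2)$$ is invariant with respect to $G_{\varepsilon,3}$ if and only if $$0.397 \approx \varepsilon^* =\frac{1}{6}\left(7-4\sqrt[3]{\frac{2}{43-3\sqrt{177}}}-\sqrt[3]{\frac{43-3\sqrt{177}}{2}} \right) \leq \varepsilon,$$ and it is symmetric with respect to $S_3$ and $S_4$, but asymmetric with respect to $S_0$, $S_1$, $S_2$, $S_5$ and $S_6$.
   Context: Let $\mathbb{T}=\mathbb{R}/\mathbb{Z}$ and $\mathbb{T}^3=(\mathbb{R}/\mathbb{Z})^3$, represented as the unit cube with opposite faces identified, with coordinates $(p,q,r)$. The coupling parameter $\varepsilon$ lies in $[0,1/2)$. Let $g:\mathbb{R}\to\mathbb{R}$ be the $1$-periodic function with $g(u)=u$ for $u\in(-1/2,1/2)$ and $g(\pm 1/2)=0$. The map $G_{\varepsilon,3}:\mathbb{T}^3\to\mathbb{T}^3$ is $G_{\varepsilon,3}(p,q,r)=(p',q',r') \bmod 1$ (coordinatewise), where $p'=2p+\frac{\varepsilon}{2}\left(-2g(p)+g(q)+g(q+r)-g(p+q)-g(p+q+r)\right)$, $q'=2q+\frac{\varepsilon}{2}\left(-2g(q)+g(p)+g(r)-g(q+r)-g(p+q)\right)$, $r'=2r+\frac{\varepsilon}{2}\left(-2g(r)+g(q)+g(p+q)-g(q+r)-g(p+q+r)\right)$. Symmetries of $G_{\varepsilon,3}$ (maps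 of $\mathbb{T}^3$ commuting with it, all mod 1): $S_0(p,q,r)=(1-p,1-q,1-r)$, $S_1(p,q,r)=(-p,\,p+q,\,r)$, $S_2(p,q,r)=(-q,\,-p,\,p+q+r)$, $S_3(p,q,r)=(-q-r,\,q,\,-p-q)$, $S_4(p,q,r)=(p+q,\,-q,\,q+r)$, $S_5(p,q,r)=(p+q+r,\,-r,\,-q)$, $S_6(p,q,r)=(p,\,q+r,\,-r)$. Products denote composition: $S_3S_4(P)=S_3(S_4(P))$. A set $\mathcal{B}\subset\mathbb{T}^3$ is symmetric with respect to $S$ if $\mathcal{B}=S\mathcal{B}$, and asymmetric with respect to $S$ if $\mathcal{B}$ and $S\mathcal{B}$ are disjoint. A set $\mathcal{B}\subset\mathbb{T}^3$ is (forward) invariant with respect to $G_{\varepsilon,3}$ if $G_{\varepsilon,3}(\mathcal{B})\subseteq\mathcal{B}$. Put $p^*=\frac{\varepsilon-2}{4\varepsilon-6}$. The polyhedra $P_1,P_2$, given by linear inequalities in $\mathbb{R}^3$ and viewed as subsets of $\mathbb{T}^3$, are $P_1=\{(p,q,r):\ q>\varepsilon/2,\ r>0,\ p+q>1-p^*,\ q+r<p^*,\ p+q+r<1-\varepsilon/2\}$, $P_2=\{(p,q,r):\ p<1,\ r>0,\ p+q>1+p^*,\ q+r<1-p^*\}$.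
   Formalization: Invariance is required only at points of A where none of p, q, r, p+q, q+r, p+q+r is 1/2 mod 1; with g(±1/2)=0 literal invariance fails for every ε in [0,1/2), e.g. (11/12,1/2,1/24) in P_2 is mapped to q=0 mod 1, outside A. *)

theory Defs
  imports Complex_Main
begin

text \<open>The torus \<open>(\<real>/\<int>)\<^sup>3\<close>, as triples of reals modulo coordinatewise integer translations.\<close>

definition torus_rel :: "real \<times> real \<times> real \<Rightarrow> real \<times> real \<times> real \<Rightarrow> bool" where
  "torus_rel = (\<lambda>(p, q, r) (p', q', r'). p - p' \<in> \<int> \<and> q - q' \<in> \<int> \<and> r - r' \<in> \<int>)"

lemma torus_rel_iff:
  "torus_rel (p, q, r) (p', q', r') \<longleftrightarrow> p - p' \<in> \<int> \<and> q - q' \<in> \<int> \<and> r - r' \<in> \<int>"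
  by (simp add: torus_rel_def)

quotient_type torus3 = "real \<times> real \<times> real" / torus_rel
proof (rule equivpI)
  show "reflp torus_rel"
    by (auto simp: reflp_def torus_rel_iff)
  have minus: "b - a \<in> \<int>" if "a - b \<in> \<int>" for a b :: real
    using Ints_minus[OF that] by simp
  show "symp torus_rel"
    by (auto simp: symp_def torus_rel_iff intro: minus)
  have add: "a - c \<in> \<int>" if "a - b \<in> \<int>" "b - c \<in> \<int>" for a b c :: real
    using Ints_add[OF that] by simp
  show "transp torus_rel"
    by (auto simp: transp_def torus_rel_iff intro: add)
qed

lemma torus_relE:
  assumes "torus_rel x y"
  obtains p q r i j k where
    "x = (p, q, r)" "y = (p + of_int i, q + of_int j, r + of_int k)"
proof -
  obtain p q r p' q' r' where eq: "x = (p, q, r)" "y = (p', q', r')"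
    by (cases x, cases y) auto
  then have "p - p' \<in> \<int>" "q - q' \<in> \<int>" "r - r' \<in> \<int>"
    using assms by (simp_all add: torus_rel_iff)
  then obtain i j k where "p - p' = of_int i" "q - q' = of_int j" "r - r' = of_int k"
    by (elim Ints_cases)
  then have "p' = p + of_int (- i)" "q' = q + of_int (- j)" "r' = r + of_int (- k)"
    by simp_all
  then show ?thesis
    using that eq by blast
qed

lift_definition torus_of :: "real \<times> real \<times> real \<Rightarrow> torus3" is "\<lambda>x. x" .

definition g :: "real \<Rightarrow> real" where
  "g u = (if u - 1/2 \<in> \<int> then 0 else u - of_int (round u))"

lemma g_periodic: "g (u + of_int n) = g u"
proof -
  have "u + of_int n - 1/2 = (u - 1/2) + of_int n"
    by simp
  then have "u + of_int n - 1/2 \<in> \<int> \<longleftrightarrow> u - 1/2 \<in> \<int>"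
    by (metis Ints_add Ints_diff Ints_of_int add_diff_cancel_right')
  moreover have "round (u + of_int n) = round u + n"
    using floor_add_int[of "u + 1/2" n] by (simp add: round_def algebra_simps)
  ultimately show ?thesis
    by (simp add: g_def)
qed

lemma g_eq_self:
  assumes "-1/2 < u" "u < 1/2"
  shows "g u = u"
proof -
  have "round u = 0"
    using assms by (intro round_unique) auto
  moreover have "u - 1/2 \<notin> \<int>"
  proof
    assume "u - 1/2 \<in> \<int>"
    then obtain z where "u - 1/2 = of_int z"
      by (elim Ints_cases)
    with assms have "(of_int (-1) :: real) < of_int z" "of_int z < (of_int 0 :: real)"
      by simp_all
    then have "-1 < z" "z < 0"
      unfolding of_int_less_iff .
    then show False
      by simp
  qed
  ultimately show ?thesis
    by (simp add: g_def)
qed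

lemma g_half: "g (1/2) = 0" "g (-1/2) = 0"
  by (simp_all add: g_def)

lemma g_cong: "u - v \<in> \<int> \<Longrightarrow> g u = g v"
  using g_periodic[of v] by (auto elim!: Ints_cases simp: algebra_simps)

definition G_lift :: "real \<Rightarrow> real \<times> real \<times> real \<Rightarrow> real \<times> real \<times> real" where
  "G_lift \<epsilon> = (\<lambda>(p, q, r).
     (2 * p + \<epsilon>/2 * (- 2 * g p + g q + g (q + r) - g (p + q) - g (p + q + r)),
      2 * q + \<epsilon>/2 * (- 2 * g q + g p + g r - g (q + r) - g (p + q)),
      2 * r + \<epsilon>/2 * (- 2 * g r + g q + g (p + q) - g (q + r) - g (p + q + r))))"

lift_definition G :: "real \<Rightarrow> torus3 \<Rightarrow> torus3" is G_lift
proof -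
  fix \<epsilon> :: real and x y :: "real \<times> real \<times> real"
  assume "torus_rel x y"
  then obtain p q r i j k where
    eq: "x = (p, q, r)" "y = (p + of_int i, q + of_int j, r + of_int k)"
    by (rule torus_relE)
  have "g (p + of_int i + (q + of_int j)) = g (p + q)"
    and "g (q + of_int j + (r + of_int k)) = g (q + r)"
    and "g (p + of_int i + (q + of_int j) + (r + of_int k)) = g (p + q + r)"
    by (intro g_cong; simp)+
  then show "torus_rel (G_lift \<epsilon> x) (G_lift \<epsilon> y)"
    by (simp add: eq G_lift_def torus_rel_iff g_periodic)
qed

lift_definition S\<^sub>0 :: "torus3 \<Rightarrow> torus3" is "\<lambda>(p, q, r). (1 - p, 1 - q, 1 - r)"
  by (elim torus_relE) (simp add: torus_rel_iff)

lift_definition S\<^sub>1 :: "torus3 \<Rightarrow> torus3" is "\<lambda>(p, q, r). (- p, p + q, r)"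
  by (elim torus_relE) (simp add: torus_rel_iff)

lift_definition S\<^sub>2 :: "torus3 \<Rightarrow> torus3" is "\<lambda>(p, q, r). (- q, - p, p + q + r)"
  by (elim torus_relE) (simp add: torus_rel_iff)

lift_definition S\<^sub>3 :: "torus3 \<Rightarrow> torus3" is "\<lambda>(p, q, r). (- q - r, q, - p - q)"
  by (elim torus_relE) (simp add: torus_rel_iff)

lift_definition S\<^sub>4 :: "torus3 \<Rightarrow> torus3" is "\<lambda>(p, q, r). (p + q, - q, q + r)"
  by (elim torus_relE) (simp add: torus_rel_iff)

lift_definition S\<^sub>5 :: "torus3 \<Rightarrow> torus3" is "\<lambda>(p, q, r). (p + q + r, - r, - q)"
  by (elim torus_relE) (simp add: torus_rel_iff)

lift_definition S\<^sub>6 :: "torus3 \<Rightarrow> torus3" is "\<lambda>(p, q, r). (p, q + r, - r)"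
  by (elim torus_relE) (simp add: torus_rel_iff)

definition p_star :: "real \<Rightarrow> real" where
  "p_star \<epsilon> = (\<epsilon> - 2) / (4 * \<epsilon> - 6)"

definition P\<^sub>1 :: "real \<Rightarrow> torus3 set" where
  "P\<^sub>1 \<epsilon> = torus_of ` {(p, q, r). q > \<epsilon>/2 \<and> r > 0 \<and> p + q > 1 - p_star \<epsilon> \<and>
     q + r < p_star \<epsilon> \<and> p + q + r < 1 - \<epsilon>/2}"

definition P\<^sub>2 :: "real \<Rightarrow> torus3 set" where
  "P\<^sub>2 \<epsilon> = torus_of ` {(p, q, r). p < 1 \<and> r > 0 \<and> p + q > 1 + p_star \<epsilon> \<and> q + r < 1 - p_star \<epsilon>}"

definition A :: "real \<Rightarrow> torus3 set" where
  "A \<epsilon> = P\<^sub>1 \<epsilon> \<union> P\<^sub>2 \<epsilon> \<union> S\<^sub>3 ` P\<^sub>1 \<epsilon> \<union> S\<^sub>4 ` P\<^sub>1 \<epsilon> \<union> (S\<^sub>3 \<circ> S\<^sub>4) ` P\<^sub>1 \<epsilon> \<union> S\<^sub>3 ` P\<^sub>2 \<epsilon>"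

definition eps_star :: real where
  "eps_star = 1/6 * (7 - 4 * root 3 (2 / (43 - 3 * sqrt 177)) - root 3 ((43 - 3 * sqrt 177) / 2))"

definition symmetric_wrt :: "('a \<Rightarrow> 'a) \<Rightarrow> 'a set \<Rightarrow> bool" where
  "symmetric_wrt S B \<longleftrightarrow> B = S ` B"

definition asymmetric_wrt :: "('a \<Rightarrow> 'a) \<Rightarrow> 'a set \<Rightarrow> bool" where
  "asymmetric_wrt S B \<longleftrightarrow> B \<inter> S ` B = {}"

text \<open>
  The points at which one of the six values of \<open>g\<close> in the formula for \<open>G \<epsilon>\<close> is taken at a jump.
\<close>

definition jump_set :: "torus3 set" where
  "jump_set = torus_of ` {(p, q, r). \<exists>u \<in> {p, q, r, p + q, q + r, p + q + r}. u - 1/2 \<in> \<int>}"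

text \<open>
  Forward invariance is required only where the map is not evaluated at a jump. With the
  convention \<open>g (\<plusminus>1/2) = 0\<close>, the inclusion \<open>G \<epsilon> ` A \<epsilon> \<subseteq> A \<epsilon>\<close> fails at jump points for every
  \<open>\<epsilon> \<in> [0, 1/2)\<close>: see \<open>not_invariant_at_jumps\<close> below.
\<close>

definition forward_invariant_off :: "'a set \<Rightarrow> ('a \<Rightarrow> 'a) \<Rightarrow> 'a set \<Rightarrow> bool" where
  "forward_invariant_off D f B \<longleftrightarrow> f ` (B - D) \<subseteq> B"

lemma torus_of_eq_iff: "torus_of x = torus_of y \<longleftrightarrow> torus_rel x y"
  by transfer simp

lemma S\<^sub>3_torus_of: "S\<^sub>3 (torus_of (p, q, r)) = torus_of (- q - r, q, - p - q)"
  by transfer (simp add: torus_rel_iff)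

lemma S\<^sub>4_torus_of: "S\<^sub>4 (torus_of (p, q, r)) = torus_of (p + q, - q, q + r)"
  by transfer (simp add: torus_rel_iff)

lemma G_torus_of: "G \<epsilon> (torus_of x) = torus_of (G_lift \<epsilon> x)"
  by (simp add: torus_of_def G.abs_eq)

lemma A_no_integer_q:
  assumes \<epsilon>: "0 \<le> \<epsilon>" "\<epsilon> < 1/2" and x: "torus_of (p, q, r) \<in> A \<epsilon>"
  shows "q \<notin> \<int>"
proof
  assume q: "q \<in> \<int>"
  define Q where "Q = {y. \<exists>a b c. y = torus_of (a, b, c) \<and> 0 < \<bar>b\<bar> \<and> \<bar>b\<bar> < 1}"
  have ps: "0 < p_star \<epsilon>" "p_star \<epsilon> < 3/8"
    using \<epsilon> by (auto simp: p_star_def field_simps)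
  have "P\<^sub>1 \<epsilon> \<subseteq> Q" "P\<^sub>2 \<epsilon> \<subseteq> Q"
    using \<epsilon> ps unfolding P\<^sub>1_def P\<^sub>2_def Q_def by fastforce+
  moreover have "S\<^sub>3 y \<in> Q \<and> S\<^sub>4 y \<in> Q" if "y \<in> Q" for y
  proof -
    obtain a b c where y: "y = torus_of (a, b, c)" and b: "0 < \<bar>b\<bar>" "\<bar>b\<bar> < 1"
      using \<open>y \<in> Q\<close> unfolding Q_def by blast
    from b have "0 < \<bar>- b\<bar>" "\<bar>- b\<bar> < 1"
      by simp_all
    with y b show ?thesis
      unfolding Q_def using S\<^sub>3_torus_of S\<^sub>4_torus_of by blast
  qed
  ultimately have "A \<epsilon> \<subseteq> Q"
    unfolding A_def by auto
  then obtain a b c where b: "0 < \<bar>b\<bar>" "\<bar>b\<bar> < 1" and "torus_of (p, q, r) = torus_of (a, b, c)"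
    using x unfolding Q_def by blast
  then have "q - b \<in> \<int>"
    by (simp add: torus_of_eq_iff torus_rel_iff)
  then have "b \<in> \<int>"
    using Ints_diff[OF q] by fastforce
  then show False
    using b by (auto elim!: Ints_cases)
qed

lemma not_invariant_at_jumps:
  assumes \<epsilon>: "0 \<le> \<epsilon>" "\<epsilon> < 1/2"
  shows "\<not> G \<epsilon> ` A \<epsilon> \<subseteq> A \<epsilon>"
proof
  assume inv: "G \<epsilon> ` A \<epsilon> \<subseteq> A \<epsilon>"
  let ?x = "(11/12, 1/2, 1/24) :: real \<times> real \<times> real"
  have "p_star \<epsilon> < 3/8"
    using \<epsilon> by (simp add: p_star_def field_simps)
  then have "torus_of ?x \<in> P\<^sub>2 \<epsilon>"
    unfolding P\<^sub>2_def by (intro imageI) auto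
  then have "torus_of (G_lift \<epsilon> ?x) \<in> A \<epsilon>"
    using inv by (force simp: A_def simp flip: G_torus_of)
  moreover have "g (11/12) = -1/12" "g (17/12) = 5/12" "g (13/24) = -11/24"
    using g_periodic[of "-1/12" 1] g_periodic[of "5/12" 1] g_periodic[of "-11/24" 1]
    by (simp_all add: g_eq_self)
  then have "fst (snd (G_lift \<epsilon> ?x)) = 1"
    by (simp add: G_lift_def g_half g_eq_self)
  ultimately show False
    using A_no_integer_q[OF \<epsilon>] by (cases "G_lift \<epsilon> ?x") (metis Ints_1 fst_conv snd_conv)
qed

end

theory Submission
  imports Defs
begin

text \<open>
  With \<open>u\<close> ranging over the six forms \<open>p, q, r, p + q, q + r, p + q + r\<close>, the planes
  \<open>u \<equiv> 1/2 (mod 1)\<close> cut \<open>P\<^sub>1\<close> and \<open>P\<^sub>2\<close> into cells on which \<open>G \<epsilon>\<close> is the homothety with factor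
  \<open>2 - 2\<epsilon>\<close> followed by a translation. As \<open>G \<epsilon>\<close> commutes with \<open>S\<^sub>3\<close> and \<open>S\<^sub>4\<close>, which permute the
  six pieces of \<open>A \<epsilon>\<close>, invariance has to be checked on these cells only. The value of \<open>p\<^sup>*\<close> satisfies
  \<open>(2 - 2\<epsilon>) p\<^sup>* = 1 - p\<^sup>* - \<epsilon>/2\<close>, so that the faces of the cell \<open>p < 1/2\<close> of \<open>P\<^sub>1\<close>
  that involve \<open>p\<^sup>*\<close> go to faces of \<open>P\<^sub>2\<close>;
  the binding constraint on \<open>\<epsilon>\<close> comes from the cell \<open>p > 1/2\<close> of \<open>P\<^sub>1\<close>, on which the bound
  \<open>(1 - \<epsilon>)/2\<close> of \<open>q + r\<close> is sent to \<open>(1 - \<epsilon>)\<^sup>2\<close>. Hence \<open>A \<epsilon>\<close> is invariant iff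
  \<open>(1 - \<epsilon>)\<^sup>2 \<le> p\<^sup>*\<close>. In terms of \<open>y = 7 - 6\<epsilon>\<close> this says \<open>y\<^sup>3 - 12 y \<le> 43\<close>, and Cardano's formula
  gives \<open>\<epsilon>\<^sup>*\<close>. For the asymmetries, the six pieces are translated into the unit cube, where
  disjointness is linear arithmetic.
\<close>

section \<open>Values and parity of \<open>g\<close>\<close>

lemma g_eq_shift: "of_int n - 1/2 < u \<Longrightarrow> u < of_int n + 1/2 \<Longrightarrow> g u = u - of_int n"
  using g_periodic[of "u - of_int n" n] g_eq_self[of "u - of_int n"] by simp

lemma g_eq_shift_1: "1/2 < u \<Longrightarrow> u < 3/2 \<Longrightarrow> g u = u - 1"
  using g_eq_shift[of 1 u] by simp

lemma g_eq_shift_2: "3/2 < u \<Longrightarrow> u < 5/2 \<Longrightarrow> g u = u - 2"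
  using g_eq_shift[of 2 u] by simp

lemma half_integer_uminus_iff: "- u - 1/2 \<in> \<int> \<longleftrightarrow> u - 1/2 \<in> \<int>" for u :: real
proof -
  have "- v - 1/2 \<in> \<int>" if "v - 1/2 \<in> \<int>" for v :: real
  proof -
    have "- v - 1/2 = - (v - 1/2) - 1"
      by simp
    then show ?thesis
      using that by (metis Ints_1 Ints_diff Ints_minus)
  qed
  from this[of u] this[of "- u"] show ?thesis
    by auto
qed

text \<open>The value 0 at the jumps makes \<open>g\<close> odd everywhere, so
  \<open>G \<epsilon>\<close> commutes with the symmetries even at jump points.\<close>

lemma g_minus: "g (- u) = - g u"
proof (cases "u - 1/2 \<in> \<int>")
  case True
  then show ?thesis
    using half_integer_uminus_iff[of u] by (simp add: g_def)
next
  case False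
  have "\<bar>u - of_int (round u)\<bar> \<le> 1/2"
    using of_int_round_abs_le[of u] by (simp add: abs_minus_commute)
  moreover have "\<bar>u - of_int (round u)\<bar> \<noteq> 1/2"
  proof
    assume "\<bar>u - of_int (round u)\<bar> = 1/2"
    then have "u - 1/2 = of_int (round u) \<or> u - 1/2 = of_int (round u - 1)"
      by (auto simp: abs_if split: if_splits)
    then show False
      using False by (metis Ints_of_int)
  qed
  ultimately have "of_int (round u) - 1/2 < u" "u < of_int (round u) + 1/2"
    by (auto simp: abs_if split: if_splits)
  then show ?thesis
    using g_eq_shift[of "round u" u] g_eq_shift[of "- round u" "- u"] by simp
qed

section \<open>Representatives on the torus and the action of the symmetries\<close>

lemma torus_of_eqI:
  assumes "p - p' \<in> \<int>" "q - q' \<in> \<int>" "r - r' \<in> \<int>"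
  shows "torus_of (p, q, r) = torus_of (p', q', r')"
  using assms by (simp add: torus_of_eq_iff torus_rel_iff)

lemma torus_of_surj: obtains p q r where "x = torus_of (p, q, r)"
proof -
  have "\<exists>y. x = torus_of y"
    by (induct x rule: torus3.abs_induct) (auto simp: torus_of_def)
  then show ?thesis
    using that by auto
qed

lemma S\<^sub>0_torus_of: "S\<^sub>0 (torus_of (p, q, r)) = torus_of (1 - p, 1 - q, 1 - r)"
  by transfer (simp add: torus_rel_iff)

lemma S\<^sub>1_torus_of: "S\<^sub>1 (torus_of (p, q, r)) = torus_of (- p, p + q, r)"
  by transfer (simp add: torus_rel_iff)

lemma S\<^sub>2_torus_of: "S\<^sub>2 (torus_of (p, q, r)) = torus_of (- q, - p, p + q + r)"
  by transfer (simp add: torus_rel_iff)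

lemma S\<^sub>5_torus_of: "S\<^sub>5 (torus_of (p, q, r)) = torus_of (p + q + r, - r, - q)"
  by transfer (simp add: torus_rel_iff)

lemma S\<^sub>6_torus_of: "S\<^sub>6 (torus_of (p, q, r)) = torus_of (p, q + r, - r)"
  by transfer (simp add: torus_rel_iff)

lemma S\<^sub>3_S\<^sub>3: "S\<^sub>3 (S\<^sub>3 x) = x"
  by (rule torus_of_surj[of x]) (simp add: S\<^sub>3_torus_of)

lemma S\<^sub>4_S\<^sub>4: "S\<^sub>4 (S\<^sub>4 x) = x"
  by (rule torus_of_surj[of x]) (simp add: S\<^sub>4_torus_of)

lemma S\<^sub>4_S\<^sub>3: "S\<^sub>4 (S\<^sub>3 x) = S\<^sub>3 (S\<^sub>4 x)"
  by (rule torus_of_surj[of x]) (simp add: S\<^sub>3_torus_of S\<^sub>4_torus_of algebra_simps)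

text \<open>\<open>S\<^sub>3\<close> permutes the six forms up to sign: it exchanges
  \<open>p\<close> with \<open>- (q + r)\<close> and \<open>r\<close> with \<open>- (p + q)\<close>,
  fixes \<open>q\<close> and negates \<open>p + q + r\<close>. Oddness of \<open>g\<close> does the
  rest.\<close>

lemma G_S\<^sub>3: "G \<epsilon> (S\<^sub>3 x) = S\<^sub>3 (G \<epsilon> x)"
proof (rule torus_of_surj[of x])
  fix p q r assume x: "x = torus_of (p, q, r)"
  have "g (- q - r) = - g (q + r)" "g (- p - q) = - g (p + q)" "g (- q - r + q) = - g r"
    "g (q + (- p - q)) = - g p" "g (- q - r + q + (- p - q)) = - g (p + q + r)"
    using g_minus[of "q + r"] g_minus[of "p + q"] g_minus[of r] g_minus[of p] g_minus[of "p + q + r"]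
    by (simp_all add: algebra_simps)
  then have "G_lift \<epsilon> (- q - r, q, - p - q)
      = (case G_lift \<epsilon> (p, q, r) of (p', q', r') \<Rightarrow> (- q' - r', q', - p' - q'))"
    by (simp add: G_lift_def field_simps)
  then show ?thesis
    by (simp add: x S\<^sub>3_torus_of G_torus_of split: prod.splits)
qed

lemma G_S\<^sub>4: "G \<epsilon> (S\<^sub>4 x) = S\<^sub>4 (G \<epsilon> x)"
proof (rule torus_of_surj[of x])
  fix p q r assume x: "x = torus_of (p, q, r)"
  have "g (p + q + - q) = g p" "g (- q + (q + r)) = g r" "g (p + q + - q + (q + r)) = g (p + q + r)"
    by (simp_all add: algebra_simps)
  then have "G_lift \<epsilon> (p + q, - q, q + r)
      = (case G_lift \<epsilon> (p, q, r) of (p', q', r') \<Rightarrow> (p' + q', - q', q' + r'))"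
    by (simp add: G_lift_def g_minus field_simps)
  then show ?thesis
    by (simp add: x S\<^sub>4_torus_of G_torus_of split: prod.splits)
qed

text \<open>The six forms have integer coefficients, so the jump condition can be tested on any
  representative.\<close>

lemma torus_of_in_jump_set_iff:
  "torus_of (p, q, r) \<in> jump_set \<longleftrightarrow>
    (\<exists>u \<in> {p, q, r, p + q, q + r, p + q + r}. u - 1/2 \<in> \<int>)"
proof
  assume "torus_of (p, q, r) \<in> jump_set"
  then obtain a b c where abc: "torus_rel (p, q, r) (a, b, c)"
    and u: "\<exists>u \<in> {a, b, c, a + b, b + c, a + b + c}. u - 1/2 \<in> \<int>"
    by (auto simp: jump_set_def torus_of_eq_iff)
  from abc obtain i j k where "a = p + of_int i" "b = q + of_int j" "c = r + of_int k"
    by (auto elim!: torus_relE)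
  moreover have "v - 1/2 \<in> \<int>" if "w - 1/2 \<in> \<int>" "w = v + of_int n" for v w :: real and n
    using Ints_diff[OF that(1) Ints_of_int[of n]] that(2) by (simp add: algebra_simps)
  note this[of "p + of_int i" p i] this[of "q + of_int j" q j] this[of "r + of_int k" r k]
    this[of "p + of_int i + (q + of_int j)" "p + q" "i + j"]
    this[of "q + of_int j + (r + of_int k)" "q + r" "j + k"]
    this[of "p + of_int i + (q + of_int j) + (r + of_int k)" "p + q + r" "i + j + k"]
  ultimately show "\<exists>u \<in> {p, q, r, p + q, q + r, p + q + r}. u - 1/2 \<in> \<int>"
    using u by (simp add: algebra_simps) blast
qed (auto simp: jump_set_def)

lemma S\<^sub>3_in_jump_set_iff: "S\<^sub>3 x \<in> jump_set \<longleftrightarrow> x \<in> jump_set"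
proof (rule torus_of_surj[of x])
  fix p q r assume x: "x = torus_of (p, q, r)"
  show ?thesis
    using half_integer_uminus_iff[of "q + r"] half_integer_uminus_iff[of "p + q"]
      half_integer_uminus_iff[of r] half_integer_uminus_iff[of p]
      half_integer_uminus_iff[of "p + q + r"]
    by (auto simp: x S\<^sub>3_torus_of torus_of_in_jump_set_iff algebra_simps)
qed

lemma S\<^sub>4_in_jump_set_iff: "S\<^sub>4 x \<in> jump_set \<longleftrightarrow> x \<in> jump_set"
proof (rule torus_of_surj[of x])
  fix p q r assume x: "x = torus_of (p, q, r)"
  show ?thesis
    using half_integer_uminus_iff[of q]
    by (auto simp: x S\<^sub>4_torus_of torus_of_in_jump_set_iff algebra_simps)
qed

section \<open>The pieces of \<open>A\<close> and its symmetry under \<open>S\<^sub>3\<close> and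
  \<open>S\<^sub>4\<close>\<close>

definition in_P\<^sub>1 :: "real \<Rightarrow> real \<Rightarrow> real \<Rightarrow> real \<Rightarrow> bool" where
  "in_P\<^sub>1 \<epsilon> p q r \<longleftrightarrow> q > \<epsilon>/2 \<and> r > 0 \<and> p + q > 1 - p_star \<epsilon> \<and>
     q + r < p_star \<epsilon> \<and> p + q + r < 1 - \<epsilon>/2"

definition in_P\<^sub>2 :: "real \<Rightarrow> real \<Rightarrow> real \<Rightarrow> real \<Rightarrow> bool" where
  "in_P\<^sub>2 \<epsilon> p q r \<longleftrightarrow> p < 1 \<and> r > 0 \<and> p + q > 1 + p_star \<epsilon> \<and> q + r < 1 - p_star \<epsilon>"

lemma P\<^sub>1_iff: "x \<in> P\<^sub>1 \<epsilon> \<longleftrightarrow> (\<exists>p q r. x = torus_of (p, q, r) \<and> in_P\<^sub>1 \<epsilon> p q r)"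
  by (auto simp: P\<^sub>1_def in_P\<^sub>1_def)

lemma P\<^sub>2_iff: "x \<in> P\<^sub>2 \<epsilon> \<longleftrightarrow> (\<exists>p q r. x = torus_of (p, q, r) \<and> in_P\<^sub>2 \<epsilon> p q r)"
  by (auto simp: P\<^sub>2_def in_P\<^sub>2_def)

text \<open>Modulo integers the composition is \<open>(1 - r, 1 - q, 1 - p)\<close>, which exchanges
  \<open>p < 1\<close> with \<open>r > 0\<close> and the remaining two faces with each other. Hence
  \<open>P\<^sub>2\<close> contributes two pieces to \<open>A\<close>, whereas
  \<open>P\<^sub>1\<close> contributes four.\<close>

lemma S\<^sub>3_S\<^sub>4_P\<^sub>2:
  assumes "x \<in> P\<^sub>2 \<epsilon>"
  shows "S\<^sub>3 (S\<^sub>4 x) \<in> P\<^sub>2 \<epsilon>"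
proof -
  obtain p q r where "x = torus_of (p, q, r)" and P: "in_P\<^sub>2 \<epsilon> p q r"
    using assms P\<^sub>2_iff by blast
  then have "S\<^sub>3 (S\<^sub>4 x) = torus_of (1 - r, 1 - q, 1 - p)"
    by (simp add: S\<^sub>3_torus_of S\<^sub>4_torus_of torus_of_eq_iff torus_rel_iff)
  moreover have "in_P\<^sub>2 \<epsilon> (1 - r) (1 - q) (1 - p)"
    using P by (auto simp: in_P\<^sub>2_def)
  ultimately show ?thesis
    using P\<^sub>2_iff by blast
qed

lemma S\<^sub>4_P\<^sub>2: "S\<^sub>4 ` P\<^sub>2 \<epsilon> = S\<^sub>3 ` P\<^sub>2 \<epsilon>"
  using S\<^sub>3_S\<^sub>4_P\<^sub>2 by (auto simp: image_iff) (metis S\<^sub>3_S\<^sub>3 S\<^sub>4_S\<^sub>4 S\<^sub>4_S\<^sub>3)+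

lemma S\<^sub>3_A: "S\<^sub>3 ` A \<epsilon> = A \<epsilon>"
  by (auto simp: A_def image_Un image_image S\<^sub>3_S\<^sub>3)

lemma S\<^sub>4_A: "S\<^sub>4 ` A \<epsilon> = A \<epsilon>"
proof -
  have "S\<^sub>4 ` S\<^sub>3 ` P\<^sub>2 \<epsilon> = P\<^sub>2 \<epsilon>"
    by (simp add: image_image S\<^sub>4_S\<^sub>4 flip: S\<^sub>4_P\<^sub>2)
  then have "S\<^sub>4 ` A \<epsilon> = S\<^sub>4 ` P\<^sub>1 \<epsilon> \<union> S\<^sub>3 ` P\<^sub>2 \<epsilon> \<union> (S\<^sub>3 \<circ> S\<^sub>4) ` P\<^sub>1 \<epsilon> \<union> P\<^sub>1 \<epsilon> \<union> S\<^sub>3 ` P\<^sub>1 \<epsilon> \<union> P\<^sub>2 \<epsilon>"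
    by (simp add: A_def image_Un S\<^sub>4_P\<^sub>2) (simp add: image_image S\<^sub>4_S\<^sub>4 S\<^sub>4_S\<^sub>3)
  then show ?thesis
    by (auto simp: A_def)
qed

lemma S\<^sub>3_in_A_iff: "S\<^sub>3 x \<in> A \<epsilon> \<longleftrightarrow> x \<in> A \<epsilon>"
  using S\<^sub>3_A S\<^sub>3_S\<^sub>3 by (metis imageI)

lemma S\<^sub>4_in_A_iff: "S\<^sub>4 x \<in> A \<epsilon> \<longleftrightarrow> x \<in> A \<epsilon>"
  using S\<^sub>4_A S\<^sub>4_S\<^sub>4 by (metis imageI)

section \<open>Bounds on \<open>p_star\<close> and representatives of \<open>A\<close> in the unit
  cube\<close>

lemma p_star_bounds:
  assumes "0 \<le> \<epsilon>" "\<epsilon> < 1/2"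
  shows "1/3 \<le> p_star \<epsilon>" "p_star \<epsilon> < 3/8"
  using assms by (auto simp: p_star_def field_simps)

lemma p_star_eq:
  assumes "\<epsilon> < 1/2"
  shows "(2 - 2 * \<epsilon>) * p_star \<epsilon> = 1 - p_star \<epsilon> - \<epsilon>/2"
  using assms by (simp add: p_star_def field_simps)

text \<open>
  The disjuncts follow the order of the pieces in the definition of \<open>A\<close>; the arguments come from
  inverting \<open>S\<^sub>3\<close>, \<open>S\<^sub>4\<close>, \<open>S\<^sub>3 \<circ> S\<^sub>4\<close> up to the integer translation that puts the piece into the unit cube.
\<close>

definition in_A_cube :: "real \<Rightarrow> real \<Rightarrow> real \<Rightarrow> real \<Rightarrow> bool" where
  "in_A_cube \<epsilon> p q r \<longleftrightarrow>
     in_P\<^sub>1 \<epsilon> p q r \<or> in_P\<^sub>2 \<epsilon> p q r \<or> in_P\<^sub>1 \<epsilon> (1 - q - r) q (1 - p - q) \<or>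
     in_P\<^sub>1 \<epsilon> (p + q - 1) (1 - q) (q + r - 1) \<or> in_P\<^sub>1 \<epsilon> (1 - r) (1 - q) (1 - p) \<or>
     in_P\<^sub>2 \<epsilon> (2 - q - r) q (1 - p - q)"

lemma in_A_cube_bounds:
  assumes "0 \<le> \<epsilon>" "\<epsilon> < 1/2" "in_A_cube \<epsilon> p q r"
  shows "0 < p \<and> p < 1 \<and> 0 < q \<and> q < 1 \<and> 0 < r \<and> r < 1"
  using assms(3) unfolding in_A_cube_def in_P\<^sub>1_def in_P\<^sub>2_def
  using assms(1,2) p_star_bounds[OF assms(1,2)] by (elim disjE) linarith+

lemma A_cases:
  assumes "x \<in> A \<epsilon>"
  obtains p q r where "x = torus_of (p, q, r)" "in_A_cube \<epsilon> p q r"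
proof -
  have *: "\<exists>p q r. x = torus_of (p, q, r) \<and> in_A_cube \<epsilon> p q r"
    if "x = torus_of (a, b, c)" "a - p \<in> \<int>" "b - q \<in> \<int>" "c - r \<in> \<int>" "in_A_cube \<epsilon> p q r"
    for a b c p q r
    using that torus_of_eqI[of a p b q c r] by blast
  consider "x \<in> P\<^sub>1 \<epsilon>" | "x \<in> P\<^sub>2 \<epsilon>" | y where "x = S\<^sub>3 y" "y \<in> P\<^sub>1 \<epsilon>" | y where "x = S\<^sub>4 y" "y \<in> P\<^sub>1 \<epsilon>"
    | y where "x = S\<^sub>3 (S\<^sub>4 y)" "y \<in> P\<^sub>1 \<epsilon>" | y where "x = S\<^sub>3 y" "y \<in> P\<^sub>2 \<epsilon>"
    using assms by (auto simp: A_def)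
  then have "\<exists>p q r. x = torus_of (p, q, r) \<and> in_A_cube \<epsilon> p q r"
  proof cases
    case 1
    then show ?thesis
      by (auto simp: P\<^sub>1_iff in_A_cube_def)
  next
    case 2
    then show ?thesis
      by (auto simp: P\<^sub>2_iff in_A_cube_def)
  next
    case 3
    then obtain a b c where "x = torus_of (- b - c, b, - a - b)" "in_P\<^sub>1 \<epsilon> a b c"
      by (auto simp: P\<^sub>1_iff S\<^sub>3_torus_of)
    then show ?thesis
      by (intro *[of _ _ _ "1 - b - c" b "1 - a - b"]) (auto simp: in_A_cube_def)
  next
    case 4
    then obtain a b c where "x = torus_of (a + b, - b, b + c)" "in_P\<^sub>1 \<epsilon> a b c"
      by (auto simp: P\<^sub>1_iff S\<^sub>4_torus_of)
    then show ?thesis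
      by (intro *[of _ _ _ "a + b" "1 - b" "b + c"]) (auto simp: in_A_cube_def)
  next
    case 5
    then obtain a b c where "x = torus_of (- c, - b, - a)" "in_P\<^sub>1 \<epsilon> a b c"
      by (auto simp: P\<^sub>1_iff S\<^sub>3_torus_of S\<^sub>4_torus_of)
    then show ?thesis
      by (intro *[of _ _ _ "1 - c" "1 - b" "1 - a"]) (auto simp: in_A_cube_def)
  next
    case 6
    then obtain a b c where "x = torus_of (- b - c, b, - a - b)" "in_P\<^sub>2 \<epsilon> a b c"
      by (auto simp: P\<^sub>2_iff S\<^sub>3_torus_of)
    then show ?thesis
      by (intro *[of _ _ _ "1 - b - c" b "2 - a - b"]) (auto simp: in_A_cube_def)
  qed
  then show ?thesis
    using that by blast
qed

lemma torus_of_in_A: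
  assumes "in_A_cube \<epsilon> p q r"
  shows "torus_of (p, q, r) \<in> A \<epsilon>"
proof -
  have "torus_of (p, q, r) = S\<^sub>3 (torus_of (1 - q - r, q, 1 - p - q))"
    "torus_of (p, q, r) = S\<^sub>4 (torus_of (p + q - 1, 1 - q, q + r - 1))"
    "torus_of (p, q, r) = S\<^sub>3 (S\<^sub>4 (torus_of (1 - r, 1 - q, 1 - p)))"
    "torus_of (p, q, r) = S\<^sub>3 (torus_of (2 - q - r, q, 1 - p - q))"
    by (simp_all add: S\<^sub>3_torus_of S\<^sub>4_torus_of torus_of_eq_iff torus_rel_iff)
  then show ?thesis
    using assms unfolding in_A_cube_def A_def Un_iff image_iff o_apply Bex_def
    by (elim disjE) (metis P\<^sub>1_iff P\<^sub>2_iff)+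
qed

text \<open>Representatives in the half-open cube are unique, and the chosen translates of all
  pieces lie in the open cube. Membership in \<open>A\<close> thus becomes a system of linear
  inequalities.\<close>

lemma in_A_cubeI:
  assumes \<epsilon>: "0 \<le> \<epsilon>" "\<epsilon> < 1/2" and "torus_of (p, q, r) \<in> A \<epsilon>"
    and pqr: "0 \<le> p" "p < 1" "0 \<le> q" "q < 1" "0 \<le> r" "r < 1"
  shows "in_A_cube \<epsilon> p q r"
proof -
  obtain a b c where "torus_of (p, q, r) = torus_of (a, b, c)" and A: "in_A_cube \<epsilon> a b c"
    using A_cases[OF assms(3)] by metis
  then have "p - a \<in> \<int>" "q - b \<in> \<int>" "r - c \<in> \<int>"
    by (simp_all add: torus_of_eq_iff torus_rel_iff)
  moreover have "u = v" if "u - v \<in> \<int>" "0 \<le> u" "u < 1" "0 \<le> v" "v < 1" for u v :: real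
    using that Ints_eq_abs_less1[of "u - v" 0] by simp
  ultimately have "p = a" "q = b" "r = c"
    using in_A_cube_bounds[OF \<epsilon> A] pqr by simp_all
  with A show ?thesis
    by simp
qed


section \<open>Asymmetry\<close>

lemma asymmetric_wrt_A:
  assumes "\<And>p q r. in_A_cube \<epsilon> p q r \<Longrightarrow> S (torus_of (p, q, r)) \<notin> A \<epsilon>"
  shows "asymmetric_wrt S (A \<epsilon>)"
  unfolding asymmetric_wrt_def using assms A_cases by blast

text \<open>The bounds on \<epsilon> and \<open>1/3 \<le> p_star \<epsilon> < 3/8\<close> already
  separate the pieces from their images by linear inequalities.\<close>

lemma A_asymmetric:
  assumes \<epsilon>: "0 \<le> \<epsilon>" "\<epsilon> < 1/2"
  shows "asymmetric_wrt S\<^sub>0 (A \<epsilon>)" "asymmetric_wrt S\<^sub>1 (A \<epsilon>)" "asymmetric_wrt S\<^sub>2 (A \<epsilon>)"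
    "asymmetric_wrt S\<^sub>5 (A \<epsilon>)" "asymmetric_wrt S\<^sub>6 (A \<epsilon>)"
proof -
  note defs = in_A_cube_def in_P\<^sub>1_def in_P\<^sub>2_def
  note bounds = \<epsilon> p_star_bounds[OF \<epsilon>]
  \<comment> \<open>The integers \<open>i\<close>, \<open>j\<close>, \<open>k\<close> bring an image
    point back to the cube. Where a coordinate of the image is a sum, its integer part is not fixed,
    hence the disjunctions below.\<close>
  have I: "in_A_cube \<epsilon> (a - of_int i) (b - of_int j) (c - of_int k)"
    if "torus_of (a, b, c) \<in> A \<epsilon>" "0 \<le> a - of_int i" "a - of_int i < 1"
      "0 \<le> b - of_int j" "b - of_int j < 1" "0 \<le> c - of_int k" "c - of_int k < 1"
    for a b c and i j k :: int
    using that torus_of_eqI[of a "a - of_int i" b "b - of_int j" c "c - of_int k"]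
    by (intro in_A_cubeI[OF \<epsilon>]) auto
  show "asymmetric_wrt S\<^sub>0 (A \<epsilon>)"
  proof (rule asymmetric_wrt_A, rule notI)
    fix p q r
    assume A: "in_A_cube \<epsilon> p q r" and "S\<^sub>0 (torus_of (p, q, r)) \<in> A \<epsilon>"
    then have "in_A_cube \<epsilon> (1 - p) (1 - q) (1 - r)"
      using I[of "1 - p" "1 - q" "1 - r" 0 0 0] in_A_cube_bounds[OF \<epsilon> A]
      by (simp add: S\<^sub>0_torus_of)
    with A show False
      unfolding defs using bounds by (elim disjE) linarith+
  qed
  show "asymmetric_wrt S\<^sub>1 (A \<epsilon>)"
  proof (rule asymmetric_wrt_A, rule notI)
    fix p q r
    assume A: "in_A_cube \<epsilon> p q r" and S: "S\<^sub>1 (torus_of (p, q, r)) \<in> A \<epsilon>"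
    have "in_A_cube \<epsilon> (1 - p) (p + q) r \<or> in_A_cube \<epsilon> (1 - p) (p + q - 1) r"
      using S I[of "- p" "p + q" r "-1" 0 0] I[of "- p" "p + q" r "-1" 1 0]
        in_A_cube_bounds[OF \<epsilon> A]
      by (cases "p + q < 1") (simp_all add: S\<^sub>1_torus_of)
    with A show False
      unfolding defs using bounds by (elim disjE) linarith+
  qed
  show "asymmetric_wrt S\<^sub>2 (A \<epsilon>)"
  proof (rule asymmetric_wrt_A, rule notI)
    fix p q r
    assume A: "in_A_cube \<epsilon> p q r" and S: "S\<^sub>2 (torus_of (p, q, r)) \<in> A \<epsilon>"
    have "in_A_cube \<epsilon> (1 - q) (1 - p) (p + q + r) \<or> in_A_cube \<epsilon> (1 - q) (1 - p) (p + q + r - 1)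
        \<or> in_A_cube \<epsilon> (1 - q) (1 - p) (p + q + r - 2)"
      using S I[of "- q" "- p" "p + q + r" "-1" "-1" 0] I[of "- q" "- p" "p + q + r" "-1" "-1" 1]
        I[of "- q" "- p" "p + q + r" "-1" "-1" 2] in_A_cube_bounds[OF \<epsilon> A]
      by (cases "p + q + r < 1"; cases "p + q + r < 2") (simp_all add: S\<^sub>2_torus_of)
    with A show False
      unfolding defs using bounds by (elim disjE) linarith+
  qed
  show "asymmetric_wrt S\<^sub>5 (A \<epsilon>)"
  proof (rule asymmetric_wrt_A, rule notI)
    fix p q r
    assume A: "in_A_cube \<epsilon> p q r" and S: "S\<^sub>5 (torus_of (p, q, r)) \<in> A \<epsilon>"
    have "in_A_cube \<epsilon> (p + q + r) (1 - r) (1 - q) \<or> in_A_cube \<epsilon> (p + q + r - 1) (1 - r) (1 - q)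
        \<or> in_A_cube \<epsilon> (p + q + r - 2) (1 - r) (1 - q)"
      using S I[of "p + q + r" "- r" "- q" 0 "-1" "-1"] I[of "p + q + r" "- r" "- q" 1 "-1" "-1"]
        I[of "p + q + r" "- r" "- q" 2 "-1" "-1"] in_A_cube_bounds[OF \<epsilon> A]
      by (cases "p + q + r < 1"; cases "p + q + r < 2") (simp_all add: S\<^sub>5_torus_of)
    with A show False
      unfolding defs using bounds by (elim disjE) linarith+
  qed
  show "asymmetric_wrt S\<^sub>6 (A \<epsilon>)"
  proof (rule asymmetric_wrt_A, rule notI)
    fix p q r
    assume A: "in_A_cube \<epsilon> p q r" and S: "S\<^sub>6 (torus_of (p, q, r)) \<in> A \<epsilon>"
    have "in_A_cube \<epsilon> p (q + r) (1 - r) \<or> in_A_cube \<epsilon> p (q + r - 1) (1 - r)"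
      using S I[of p "q + r" "- r" 0 0 "-1"] I[of p "q + r" "- r" 0 1 "-1"]
        in_A_cube_bounds[OF \<epsilon> A]
      by (cases "q + r < 1") (simp_all add: S\<^sub>6_torus_of)
    with A show False
      unfolding defs using bounds by (elim disjE) linarith+
  qed
qed

section \<open>Invariance when \<open>(1 - \<epsilon>)^2 \<le> p_star \<epsilon>\<close>\<close>

text \<open>Of the jump planes only \<open>p = 1/2\<close> meets \<open>P\<^sub>1\<close>: there
  \<open>q + r < 3/8\<close>, while \<open>p + q\<close> and \<open>p + q + r\<close> lie between
  5/8 and 1. The cell \<open>p < 1/2\<close> goes to \<open>P\<^sub>2\<close>, the cell
  \<open>p > 1/2\<close> back to \<open>P\<^sub>1\<close>.\<close>

lemma G_P\<^sub>1:
  assumes \<epsilon>: "0 \<le> \<epsilon>" "\<epsilon> < 1/2" and crit: "(1 - \<epsilon>)^2 \<le> p_star \<epsilon>"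
    and x: "x \<in> P\<^sub>1 \<epsilon>" "x \<notin> jump_set"
  shows "G \<epsilon> x \<in> A \<epsilon>"
proof -
  obtain p q r where x_eq: "x = torus_of (p, q, r)" and P: "in_P\<^sub>1 \<epsilon> p q r"
    using x(1) P\<^sub>1_iff by blast
  note P = P[unfolded in_P\<^sub>1_def]
  define w where "w = 2 - 2 * \<epsilon>"
  have scale: "w * u < w * v" if "u < v" for u v
    using that \<epsilon> by (simp add: w_def)
  have M: "w * (\<epsilon>/2) < w * q" "w * 0 < w * r"
    "w * (1 - p_star \<epsilon>) < w * (p + q)"
    "w * (q + r) < w * p_star \<epsilon>"
    "w * (p + q + r) < w * (1 - \<epsilon>/2)"
    using P by (intro scale; simp)+
  note ps = p_star_bounds[OF \<epsilon>] and ps_eq = p_star_eq[OF \<epsilon>(2), folded w_def]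
  \<comment> \<open>The two bounds drawn from this replace the terms in \<open>\<epsilon>^2\<close>,
    so that the face checks become linear.\<close>
  have "0 \<le> \<epsilon> * (1/2 - \<epsilon>)"
    using \<epsilon> by simp
  then have w_\<epsilon>: "\<epsilon>/2 \<le> w * (\<epsilon>/2)" and w_1: "w * (1 - \<epsilon>/2) \<le> 2 - 5/2 * \<epsilon>"
    by (simp_all add: w_def algebra_simps)
  \<comment> \<open>\<open>p > 1/2\<close> and \<open>p + q + r < 1 - \<epsilon>/2\<close> give
    \<open>q + r < (1 - \<epsilon>)/2\<close>, and \<open>w\<close> scales this bound to
    \<open>(1 - \<epsilon>)^2\<close>.\<close>
  have w_half: "w * (1/2 - \<epsilon>/2) \<le> p_star \<epsilon>"
    using crit by (simp add: w_def power2_eq_square algebra_simps)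
  have g: "g q = q" "g r = r" "g (q + r) = q + r" "g (p + q) = p + q - 1"
    "g (p + q + r) = p + q + r - 1"
    using P \<epsilon> ps by (auto intro!: g_eq_self g_eq_shift_1)
  have "p \<noteq> 1/2"
    using x(2) unfolding x_eq torus_of_in_jump_set_iff by (intro notI) simp
  then consider "p < 1/2" | "p > 1/2"
    by linarith
  then show ?thesis
  proof cases
    case 1
    have "g p = p"
      using P \<epsilon> ps 1 by (intro g_eq_self) linarith+
    then have "G_lift \<epsilon> (p, q, r) = (w * p + \<epsilon>, w * q + \<epsilon>/2, w * r)"
      by (simp add: G_lift_def g w_def, simp add: field_simps)
    moreover have "in_P\<^sub>2 \<epsilon> (w * p + \<epsilon>) (w * q + \<epsilon>/2) (w * r)"
      using M w_def ps_eq scale[OF 1]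
      unfolding in_P\<^sub>2_def distrib_left right_diff_distrib mult_1_right
      by (intro conjI; linarith)
    ultimately show ?thesis
      by (auto simp: x_eq G_torus_of A_def P\<^sub>2_iff)
  next
    case 2
    then have "g p = p - 1"
      using P \<epsilon> ps by (intro g_eq_shift_1) linarith+
    then have "G_lift \<epsilon> (p, q, r) = (w * p + 2 * \<epsilon>, w * q, w * r)"
      by (simp add: G_lift_def g w_def, simp add: field_simps)
    then have "G \<epsilon> x = torus_of (w * p + 2 * \<epsilon> - 1, w * q, w * r)"
      by (simp add: x_eq G_torus_of torus_of_eqI)
    moreover have "in_P\<^sub>1 \<epsilon> (w * p + 2 * \<epsilon> - 1) (w * q) (w * r)"
      using M w_def ps_eq w_\<epsilon> w_1 w_half \<epsilon> scale[OF 2]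
      unfolding in_P\<^sub>1_def distrib_left right_diff_distrib mult_1_right
      by (intro conjI; linarith)
    ultimately show ?thesis
      by (auto simp: A_def P\<^sub>1_iff)
  qed
qed

text \<open>Cells \<open>c1\<close> and \<open>c6\<close> go to \<open>P\<^sub>2\<close>, and
  \<open>c4\<close>, \<open>c5\<close>, \<open>c2\<close>, \<open>c3\<close> go to the images of
  \<open>P\<^sub>1\<close> under the identity, \<open>S\<^sub>3\<close>, \<open>S\<^sub>4\<close>
  and \<open>S\<^sub>3 \<circ> S\<^sub>4\<close> respectively.\<close>

lemma G_P\<^sub>2:
  assumes \<epsilon>: "0 \<le> \<epsilon>" "\<epsilon> < 1/2" and crit: "(1 - \<epsilon>)^2 \<le> p_star \<epsilon>"
    and x: "x \<in> P\<^sub>2 \<epsilon>" "x \<notin> jump_set"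
  shows "G \<epsilon> x \<in> A \<epsilon>"
proof -
  obtain p q r where x_eq: "x = torus_of (p, q, r)" and P: "in_P\<^sub>2 \<epsilon> p q r"
    using x(1) P\<^sub>2_iff by blast
  note P = P[unfolded in_P\<^sub>2_def]
  define w where "w = 2 - 2 * \<epsilon>"
  have scale: "w * u < w * v" if "u < v" for u v
    using that \<epsilon> by (simp add: w_def)
  have M: "w * p < w * 1" "w * 0 < w * r" "w * (1 + p_star \<epsilon>) < w * (p + q)"
    "w * (q + r) < w * (1 - p_star \<epsilon>)"
    using P by (intro scale; simp)+
  note ps = p_star_bounds[OF \<epsilon>] and ps_eq = p_star_eq[OF \<epsilon>(2), folded w_def]
  \<comment> \<open>Since \<open>(5/8)^2 = 25/64\<close> exceeds 3/8, \<open>crit\<close> excludes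
    \<epsilon> up to 3/8. The cells below use \<open>crit\<close> through this linear bound.\<close>
  have large: "3/8 < \<epsilon>"
  proof (rule ccontr)
    assume "\<not> 3/8 < \<epsilon>"
    then have "(5/8)^2 \<le> (1 - \<epsilon>)^2"
      by (intro power_mono) auto
    then show False
      using crit ps by (simp add: power2_eq_square)
  qed
  have g: "g p = p - 1" "g r = r"
    using P \<epsilon> ps by (auto intro!: g_eq_self g_eq_shift_1)
  \<comment> \<open>The image returns to the cube by subtracting 1 from the first coordinate and
    \<open>j\<close> from the second, with \<open>j = 1\<close> when \<open>q > 1/2\<close> and
    \<open>j = 0\<close> otherwise.\<close>
  have image: "G \<epsilon> x \<in> A \<epsilon>"
    if "G_lift \<epsilon> (p, q, r) = (a, b, c)" "in_A_cube \<epsilon> (a - 1) (b - of_int j) c" for a b c j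
    using torus_of_in_A[OF that(2)] torus_of_eqI[of a "a - 1" b "b - of_int j" c c] that(1)
    by (simp add: x_eq G_torus_of)
  have no_jump: "u - 1/2 \<noteq> 0" "u - 1/2 \<noteq> 1" if "u \<in> {q, q + r, p + q, p + q + r}" for u
    using x(2) that unfolding x_eq torus_of_in_jump_set_iff by (metis Ints_0 Ints_1 insert_iff)+
  have "q \<noteq> 1/2" "q + r \<noteq> 1/2" "p + q \<noteq> 3/2"  "p + q + r \<noteq> 3/2"
    using no_jump[of q] no_jump[of "q + r"] no_jump[of "p + q"] no_jump[of "p + q + r"] by auto
  \<comment> \<open>As \<open>p < 1\<close> and \<open>r > 0\<close>, \<open>q > 1/2\<close> forces
    \<open>q + r > 1/2\<close>, \<open>p + q > 3/2\<close> forces \<open>q > 1/2\<close> and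
    \<open>p + q + r > 3/2\<close>, and \<open>p + q + r > 3/2\<close> forces
    \<open>q + r > 1/2\<close>. Six sign patterns remain.\<close>
  then consider
    (c1) "q < 1/2" "q + r < 1/2" |
    (c2) "q < 1/2" "q + r > 1/2" "p + q + r < 3/2" |
    (c3) "q < 1/2" "q + r > 1/2" "p + q + r > 3/2" |
    (c4) "q > 1/2" "p + q < 3/2" "p + q + r < 3/2" |
    (c5) "q > 1/2" "p + q < 3/2" "p + q + r > 3/2" |
    (c6) "q > 1/2" "p + q > 3/2"
    by linarith
  then show ?thesis
  proof cases
    case c1
    then have "g q = q" "g (q + r) = q + r" "g (p + q) = p + q - 1" "g (p + q + r) = p + q + r - 1"
      using P \<epsilon> ps by (auto intro!: g_eq_self g_eq_shift_1)
    then have "G_lift \<epsilon> (p, q, r) = (w * p + 2 * \<epsilon>, w * q, w * r)"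
      by (simp add: G_lift_def g w_def, simp add: field_simps)
    moreover have "in_P\<^sub>2 \<epsilon> (w * p + 2 * \<epsilon> - 1) (w * q) (w * r)"
      using M w_def ps_eq ps large \<epsilon> c1[THEN scale]
      unfolding in_P\<^sub>2_def distrib_left right_diff_distrib mult_1_right
      by (intro conjI; linarith)
    ultimately show ?thesis
      by - (rule image[where j = 0], assumption,
          simp only: in_A_cube_def of_int_0 of_int_1 diff_0_right simp_thms)
  next
    case c2
    then have "g q = q" "g (q + r) = q + r - 1" "g (p + q) = p + q - 1" "g (p + q + r) = p + q + r - 1"
      using P \<epsilon> ps by (auto intro!: g_eq_self g_eq_shift_1)
    then have "G_lift \<epsilon> (p, q, r) = (w * p + 3/2 * \<epsilon>, w * q + \<epsilon>/2, w * r + \<epsilon>/2)"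
      by (simp add: G_lift_def g w_def, simp add: field_simps)
    moreover have "in_P\<^sub>1 \<epsilon> (w * p + 3/2 * \<epsilon> - 1 + (w * q + \<epsilon>/2) - 1)
        (1 - (w * q + \<epsilon>/2)) (w * q + \<epsilon>/2 + (w * r + \<epsilon>/2) - 1)"
      using M w_def ps_eq ps large \<epsilon> c2[THEN scale]
      unfolding in_P\<^sub>1_def distrib_left right_diff_distrib mult_1_right
      by (intro conjI; linarith)
    ultimately show ?thesis
      by - (rule image[where j = 0], assumption,
          simp only: in_A_cube_def of_int_0 of_int_1 diff_0_right simp_thms)
  next
    case c3
    then have "g q = q" "g (q + r) = q + r - 1" "g (p + q) = p + q - 1" "g (p + q + r) = p + q + r - 2"
      using P \<epsilon> ps by (auto intro!: g_eq_self g_eq_shift_1 g_eq_shift_2)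
    then have "G_lift \<epsilon> (p, q, r) = (w * p + 2 * \<epsilon>, w * q + \<epsilon>/2, w * r + \<epsilon>)"
      by (simp add: G_lift_def g w_def, simp add: field_simps)
    moreover have "in_P\<^sub>1 \<epsilon> (1 - (w * r + \<epsilon>)) (1 - (w * q + \<epsilon>/2)) (1 - (w * p + 2 * \<epsilon> - 1))"
      using M w_def ps_eq ps large \<epsilon> c3[THEN scale]
      unfolding in_P\<^sub>1_def distrib_left right_diff_distrib mult_1_right
      by (intro conjI; linarith)
    ultimately show ?thesis
      by - (rule image[where j = 0], assumption,
          simp only: in_A_cube_def of_int_0 of_int_1 diff_0_right simp_thms)
  next
    case c4
    then have "g q = q - 1" "g (q + r) = q + r - 1" "g (p + q) = p + q - 1" "g (p + q + r) = p + q + r - 1"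
      using P \<epsilon> ps by (auto intro!: g_eq_self g_eq_shift_1)
    then have "G_lift \<epsilon> (p, q, r) = (w * p + \<epsilon>, w * q + 3/2 * \<epsilon>, w * r)"
      by (simp add: G_lift_def g w_def, simp add: field_simps)
    moreover have "in_P\<^sub>1 \<epsilon> (w * p + \<epsilon> - 1) (w * q + 3/2 * \<epsilon> - 1) (w * r)"
      using M w_def ps_eq ps large \<epsilon> c4[THEN scale]
      unfolding in_P\<^sub>1_def distrib_left right_diff_distrib mult_1_right
      by (intro conjI; linarith)
    ultimately show ?thesis
      by - (rule image[where j = 1], assumption,
          simp only: in_A_cube_def of_int_0 of_int_1 diff_0_right simp_thms)
  next
    case c5
    then have "g q = q - 1" "g (q + r) = q + r - 1" "g (p + q) = p + q - 1" "g (p + q + r) = p + q + r - 2"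
      using P \<epsilon> ps by (auto intro!: g_eq_self g_eq_shift_1 g_eq_shift_2)
    then have "G_lift \<epsilon> (p, q, r) = (w * p + 3/2 * \<epsilon>, w * q + 3/2 * \<epsilon>, w * r + \<epsilon>/2)"
      by (simp add: G_lift_def g w_def, simp add: field_simps)
    moreover have "in_P\<^sub>1 \<epsilon> (1 - (w * q + 3/2 * \<epsilon> - 1) - (w * r + \<epsilon>/2)) (w * q + 3/2 * \<epsilon> - 1)
        (1 - (w * p + 3/2 * \<epsilon> - 1) - (w * q + 3/2 * \<epsilon> - 1))"
      using M w_def ps_eq ps large \<epsilon> c5[THEN scale]
      unfolding in_P\<^sub>1_def distrib_left right_diff_distrib mult_1_right
      by (intro conjI; linarith)
    ultimately show ?thesis
      by - (rule image[where j = 1], assumption,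
          simp only: in_A_cube_def of_int_0 of_int_1 diff_0_right simp_thms)
  next
    case c6
    then have "g q = q - 1" "g (q + r) = q + r - 1" "g (p + q) = p + q - 2" "g (p + q + r) = p + q + r - 2"
      using P \<epsilon> ps by (auto intro!: g_eq_self g_eq_shift_1 g_eq_shift_2)
    then have "G_lift \<epsilon> (p, q, r) = (w * p + 2 * \<epsilon>, w * q + 2 * \<epsilon>, w * r)"
      by (simp add: G_lift_def g w_def, simp add: field_simps)
    moreover have "in_P\<^sub>2 \<epsilon> (w * p + 2 * \<epsilon> - 1) (w * q + 2 * \<epsilon> - 1) (w * r)"
      using M w_def ps_eq ps large \<epsilon> c6[THEN scale]
      unfolding in_P\<^sub>2_def distrib_left right_diff_distrib mult_1_right
      by (intro conjI; linarith)
    ultimately show ?thesis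
      by - (rule image[where j = 1], assumption,
          simp only: in_A_cube_def of_int_0 of_int_1 diff_0_right simp_thms)
  qed
qed

lemma forward_invariant_A:
  assumes \<epsilon>: "0 \<le> \<epsilon>" "\<epsilon> < 1/2" and crit: "(1 - \<epsilon>)^2 \<le> p_star \<epsilon>"
  shows "forward_invariant_off jump_set (G \<epsilon>) (A \<epsilon>)"
proof -
  have PI: "G \<epsilon> y \<in> A \<epsilon>" if "y \<in> P\<^sub>1 \<epsilon> \<union> P\<^sub>2 \<epsilon>" "y \<notin> jump_set" for y
    using that G_P\<^sub>1[OF assms] G_P\<^sub>2[OF assms] by blast
  have "G \<epsilon> x \<in> A \<epsilon>" if x: "x \<in> A \<epsilon>" "x \<notin> jump_set" for x
  proof -
    have "\<exists>y \<in> P\<^sub>1 \<epsilon> \<union> P\<^sub>2 \<epsilon>. x = y \<or> x = S\<^sub>3 y \<or> x = S\<^sub>4 y \<or> x = S\<^sub>3 (S\<^sub>4 y)"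
      using x(1) by (auto simp: A_def)
    then show ?thesis
      using x(2) PI
      by (auto simp: G_S\<^sub>3 G_S\<^sub>4 S\<^sub>3_in_A_iff S\<^sub>4_in_A_iff S\<^sub>3_in_jump_set_iff S\<^sub>4_in_jump_set_iff)
  qed
  then show ?thesis
    by (auto simp: forward_invariant_off_def)
qed

section \<open>Failure of invariance when
  \<open>p_star \<epsilon> < (1 - \<epsilon>)^2\<close>\<close>

lemma not_forward_invariant_A:
  assumes \<epsilon>: "0 \<le> \<epsilon>" "\<epsilon> < 1/2" and crit: "p_star \<epsilon> < (1 - \<epsilon>)^2"
  shows "\<not> forward_invariant_off jump_set (G \<epsilon>) (A \<epsilon>)"
proof
  assume inv: "forward_invariant_off jump_set (G \<epsilon>) (A \<epsilon>)"
  define w where "w = 2 - 2 * \<epsilon>"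
  have w: "1 < w"
    using \<epsilon> by (simp add: w_def)
  note ps = p_star_bounds[OF \<epsilon>]
  \<comment> \<open>\<open>s\<close> is the value of \<open>q + r\<close> sent to \<open>p\<^sup>*\<close>: the image lies on a face of the open piece \<open>P\<^sub>1\<close>.\<close>
  define s where "s = p_star \<epsilon> / w"
  have s: "w * s = p_star \<epsilon>"
    using w by (simp add: s_def)
  have "w * s < w * ((1 - \<epsilon>)/2)"
    using crit unfolding s by (simp add: w_def power2_eq_square field_simps)
  then have s_less: "s < (1 - \<epsilon>)/2"
    using w by simp
  \<comment> \<open>This is \<open>\<epsilon> - \<epsilon>^2 \<le> 1/4 < 1/3 \<le> p_star
    \<epsilon>\<close>.\<close>
  have "w * (\<epsilon>/2) < w * s"
    unfolding s using \<epsilon> ps mult_nonneg_nonneg[of "1/2 - \<epsilon>" "1/2 - \<epsilon>"]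
    by (simp add: w_def algebra_simps)
  then have s_gt: "\<epsilon>/2 < s"
    using w by simp
  have "1 * s < w * s"
    using w s_gt \<epsilon> by (intro mult_strict_right_mono) auto
  then have s_less': "s < p_star \<epsilon>"
    using s by simp
  define m where "m = min (s - \<epsilon>/2) (min (p_star \<epsilon> - \<epsilon>/2) ((1 - \<epsilon>)/2 - s))"
  have "0 < m" "m \<le> s - \<epsilon>/2" "m \<le> p_star \<epsilon> - \<epsilon>/2" "m \<le> (1 - \<epsilon>)/2 - s"
    using s_less s_less' s_gt by (auto simp: m_def)
  then obtain h where h: "0 < h" "h < s - \<epsilon>/2" "2 * h < p_star \<epsilon> - \<epsilon>/2" "h < (1 - \<epsilon>)/2 - s"
    by (intro that[of "m / 3"]; linarith)
  \<comment> \<open>Here \<open>q + r = s\<close> exactly, and \<open>p + q + r\<close> is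
    \<open>h\<close> below \<open>1 - \<epsilon>/2\<close>. The three upper bounds on
    \<open>h\<close> amount to \<open>q > \<epsilon>/2\<close>,
    \<open>p + q > 1 - p_star \<epsilon>\<close> and \<open>p > 1/2\<close>, in this order.\<close>
  define p q r where "p = 1 - \<epsilon>/2 - s - h" and "q = s - h" and "r = h"
  note pqr = p_def q_def r_def
  have P: "in_P\<^sub>1 \<epsilon> p q r"
    using h s_less' by (simp add: in_P\<^sub>1_def pqr)
  have p: "1/2 < p" "p < 1"
    using h s_gt \<epsilon> by (simp_all add: pqr field_simps)
  note P' = P[unfolded in_P\<^sub>1_def]
  have no_half: "u - 1/2 \<notin> \<int>" if "0 < u" "u < 1" "u \<noteq> 1/2" for u :: real
  proof
    assume "u - 1/2 \<in> \<int>"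
    moreover have "\<bar>u - 1/2 - 0\<bar> < 1"
      using that by linarith
    ultimately show False
      using that Ints_eq_abs_less1[of "u - 1/2" 0] by simp
  qed
  have "u - 1/2 \<notin> \<int>" if "u \<in> {p, q, r, p + q, q + r, p + q + r}" for u
    using that P' p ps \<epsilon> by (elim insertE emptyE; intro no_half; linarith)
  then have "torus_of (p, q, r) \<notin> jump_set"
    unfolding torus_of_in_jump_set_iff by blast
  moreover have "torus_of (p, q, r) \<in> A \<epsilon>"
    using P by (auto simp: A_def P\<^sub>1_iff)
  ultimately have "G \<epsilon> (torus_of (p, q, r)) \<in> A \<epsilon>"
    using inv by (auto simp: forward_invariant_off_def)
  moreover have "g p = p - 1" "g q = q" "g r = r" "g (q + r) = q + r" "g (p + q) = p + q - 1"
    "g (p + q + r) = p + q + r - 1"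
    using P' p \<epsilon> ps by (auto intro!: g_eq_self g_eq_shift_1)
  then have "G_lift \<epsilon> (p, q, r) = (w * p + 2 * \<epsilon>, w * q, w * r)"
    by (simp add: G_lift_def w_def, simp add: field_simps)
  moreover have "torus_of (w * p + 2 * \<epsilon> - 1, w * q, w * r)
      = torus_of (w * p + 2 * \<epsilon>, w * q, w * r)"
    by (rule torus_of_eqI) simp_all
  ultimately have "torus_of (w * p + 2 * \<epsilon> - 1, w * q, w * r) \<in> A \<epsilon>"
    by (simp add: G_torus_of)
  moreover have scale: "w * u < w * v" if "u < v" for u v
    using that w by simp
  have M: "w * (1/2) < w * p" "w * 0 < w * q" "w * 0 < w * r" "w * (p + q + r) < w * (1 - \<epsilon>/2)"
    using P' p \<epsilon> by (intro scale; simp)+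
  have qr: "w * q + w * r = p_star \<epsilon>"
    using s by (simp add: pqr algebra_simps)
  have "w * p + 2 * \<epsilon> - 1 + w * q + w * r < 1"
    using M(4) \<epsilon> mult_nonneg_nonneg[of \<epsilon> "1/2 - \<epsilon>"] by (simp add: w_def algebra_simps)
  moreover have "0 < w * p + 2 * \<epsilon> - 1" "0 < w * q" "0 < w * r"
    using M w_def \<epsilon> by - linarith+
  ultimately have "in_A_cube \<epsilon> (w * p + 2 * \<epsilon> - 1) (w * q) (w * r)"
    by (intro in_A_cubeI[OF \<epsilon>]) auto
  \<comment> \<open>For the image point, \<open>q + r = p_star \<epsilon>\<close> violates the
    strict inequality of \<open>P\<^sub>1\<close>; its coordinates are positive with sum below 1,
    which excludes the other five pieces.\<close>
  then show False
    unfolding in_A_cube_def in_P\<^sub>1_def in_P\<^sub>2_def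
    using qr \<open>w * p + 2 * \<epsilon> - 1 + w * q + w * r < 1\<close> \<open>0 < w * p + 2 * \<epsilon> - 1\<close> \<open>0 < w * q\<close>
      \<open>0 < w * r\<close> ps by (elim disjE) linarith+
qed

section \<open>The critical parameter as a root of a cubic\<close>

text \<open>The difference of the two values is
  \<open>(z - y) * (z * z + y * z + y * y - 12)\<close>, whose second factor is at least 36. The
  bound 4 suits both uses: \<open>7 - 6 * \<epsilon> > 4\<close> for
  \<open>\<epsilon> < 1/2\<close>, and \<open>t + 4 / t \<ge> 4\<close> for
  \<open>t > 0\<close>.\<close>

lemma cubic_less_iff:
  fixes y z :: real
  assumes "4 \<le> y" "4 \<le> z"
  shows "y^3 - 12 * y < z^3 - 12 * z \<longleftrightarrow> y < z"
proof -
  have "4 * 4 \<le> y * y" "4 * 4 \<le> z * z" "4 * 4 \<le> y * z"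
    using assms by (intro mult_mono; simp)+
  then have pos: "0 < z * z + y * z + y * y - 12"
    by simp
  have "y^3 - 12 * y < z^3 - 12 * z \<longleftrightarrow> 0 < (z - y) * (z * z + y * z + y * y - 12)"
    by (simp add: power3_eq_cube algebra_simps)
  also have "\<dots> \<longleftrightarrow> y < z"
    using pos by (simp add: zero_less_mult_iff)
  finally show ?thesis .
qed

lemma eps_star_cubic:
  defines "y \<equiv> 7 - 6 * eps_star"
  shows "4 \<le> y" "y^3 - 12 * y = 43"
proof -
  define d where "d = 43 - 3 * sqrt 177"
  define t where "t = root 3 (d / 2)"
  have d: "0 < d"
    using real_less_lsqrt[of "43/3" 177] by (simp add: d_def power2_eq_square)
  have t: "0 < t"
    using d by (simp add: t_def)
  have t3: "t^3 = d / 2"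
    by (simp add: t_def odd_real_root_pow)
  have "root 3 (2 / d) = inverse t"
    by (simp add: t_def flip: real_root_inverse)
  \<comment> \<open>Cardano: \<open>(t + 4/t)\<^sup>3 - 12 (t + 4/t) = t\<^sup>3 + 64/t\<^sup>3\<close>\<close>
  then have y: "y = t + 4 / t"
    by (simp add: y_def eps_star_def t_def d_def field_simps)
  have "0 \<le> (t - 2)^2"
    by simp
  then show "4 \<le> y"
    using t by (simp add: y field_simps power2_eq_square)
  \<comment> \<open>As \<open>43^2 - 9 * 177 = 256\<close>, the number \<open>64 / t^3\<close> is
    the conjugate of \<open>t^3\<close>, and the square roots cancel in the sum.\<close>
  have "d * (43 + 3 * sqrt 177) = 256"
    by (simp add: d_def algebra_simps)
  then have "64 / t^3 = (43 + 3 * sqrt 177) / 2"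
    using d by (simp add: t3 field_simps)
  moreover have "y^3 - 12 * y = t^3 + 64 / t^3"
    using t by (simp add: y power3_eq_cube field_simps)
  ultimately show "y^3 - 12 * y = 43"
    unfolding t3 d_def by (simp only: flip: add_divide_distrib) simp
qed

text \<open>The endpoints 0.3975 and 0.3965 correspond to 4.615 and 4.621 under
  \<open>7 - 6 * \<epsilon>\<close>, so it suffices to compare the cubic there with 43.\<close>

lemma eps_star_approx: "\<bar>eps_star - 0.397\<bar> < 0.0005"
proof -
  let ?y = "7 - 6 * eps_star"
  have "?y < 4.621"
    using cubic_less_iff[of ?y "4.621"] eps_star_cubic by (simp add: power3_eq_cube)
  moreover have "4.615 < ?y"
    using cubic_less_iff[of "4.615" ?y] eps_star_cubic by (simp add: power3_eq_cube)
  ultimately show ?thesis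
    by (simp add: abs_if)
qed

text \<open>The substitution \<open>7 - 6 * \<epsilon>\<close> reverses the order; multiplying by
  the positive denominator \<open>6 - 4 * \<epsilon>\<close> of \<open>p_star \<epsilon>\<close>
  turns the condition into the cubic inequality, up to the factor 54.\<close>

lemma eps_star_le_iff:
  assumes "0 \<le> \<epsilon>" "\<epsilon> < 1/2"
  shows "eps_star \<le> \<epsilon> \<longleftrightarrow> (1 - \<epsilon>)^2 \<le> p_star \<epsilon>"
proof -
  let ?y = "7 - 6 * \<epsilon>"
  have scaled: "43 + 54 * (u - v) \<le> 43 \<longleftrightarrow> u \<le> v" for u v :: real
    by auto
  have "eps_star \<le> \<epsilon> \<longleftrightarrow> ?y^3 - 12 * ?y \<le> 43"
    using cubic_less_iff[of "7 - 6 * eps_star" ?y] eps_star_cubic assms by auto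
  also have "?y^3 - 12 * ?y = 43 + 54 * ((1 - \<epsilon>)^2 * (6 - 4 * \<epsilon>) - (2 - \<epsilon>))"
    by (simp add: power2_eq_square power3_eq_cube algebra_simps)
  also have "\<dots> \<le> 43 \<longleftrightarrow> (1 - \<epsilon>)^2 * (6 - 4 * \<epsilon>) \<le> 2 - \<epsilon>"
    using scaled by blast
  also have "\<dots> \<longleftrightarrow> (1 - \<epsilon>)^2 \<le> (2 - \<epsilon>) / (6 - 4 * \<epsilon>)"
    using assms by (simp add: pos_le_divide_eq)
  also have "(2 - \<epsilon>) / (6 - 4 * \<epsilon>) = p_star \<epsilon>"
    using assms by (simp add: p_star_def field_simps)
  finally show ?thesis .
qed

theorem proposition1:
  fixes \<epsilon> :: real
  assumes "0 \<le> \<epsilon>" and "\<epsilon> < 1/2"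
  shows "(forward_invariant_off jump_set (G \<epsilon>) (A \<epsilon>) \<longleftrightarrow> eps_star \<le> \<epsilon>) \<and>
         \<bar>eps_star - 0.397\<bar> < 0.0005 \<and>
         symmetric_wrt S\<^sub>3 (A \<epsilon>) \<and> symmetric_wrt S\<^sub>4 (A \<epsilon>) \<and>
         asymmetric_wrt S\<^sub>0 (A \<epsilon>) \<and> asymmetric_wrt S\<^sub>1 (A \<epsilon>) \<and> asymmetric_wrt S\<^sub>2 (A \<epsilon>) \<and>
         asymmetric_wrt S\<^sub>5 (A \<epsilon>) \<and> asymmetric_wrt S\<^sub>6 (A \<epsilon>)"
proof -
  have "forward_invariant_off jump_set (G \<epsilon>) (A \<epsilon>) \<longleftrightarrow> eps_star \<le> \<epsilon>"
    using forward_invariant_A[OF assms] not_forward_invariant_A[OF assms]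
    unfolding eps_star_le_iff[OF assms] by linarith
  then show ?thesis
    using eps_star_approx A_asymmetric[OF assms] by (simp add: symmetric_wrt_def S\<^sub>3_A S\<^sub>4_A)
qed

end
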